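(* Let $c_1=0.4$, $c_2=0.55$, $c_3=0.6$, $\alpha=17$, and let $F=(F_1,F_2,F_3)$ be the map defined, for $(x,y,z)\in\mathbb R^3$ with $x,y,z\ge 0$ and $x+y+z>0$, by $$F_1(x,y,z)=\frac{2x+y+z-c_1(x+y+z)^2}{2},\qquad F_2(x,y,z)=\sqrt{\frac{x+z}{c_2}}-x-z,$$ $$F_3(x,y,z)=z+\alpha z\left(-c_3+\frac{x+y}{(x+y+z)^2}\right).$$ Let $x_\ell<x_r$, $y_\ell<y_r$, $z_\ell<z_r$ be real numbers satisfying all of the following conditions: 1. $z_\ell=0$; 2. $x_\ell+y_\ell>z_r\ge\sqrt{\frac{\alpha}{\alpha c_3-1}(x_\ell+y_\ell)}-(x_\ell+y_\ell)>0$; 3. $2\left(\sqrt{\frac{\alpha}{\alpha c_3+1}(x_r+y_r)}-(x_r+y_r)\right)>z_r$; 4. $\frac1{c_1}-x_r>y_r+z_r>\frac1{2c_1}-x_\ell>0$, $\ \frac1{2c_1}-x_r>y_\ell+z_\ell$, $\ x_r\ge\frac1{4c_1}$, $\ \frac1{2c_1}\left(1-c_1(y_\ell+y_r+z_\ell+z_r)\right)\ge x_\ell>0$, $\ \sqrt{\frac{y_\ell+z_\ell}{c_1}}-(y_\ell+z_\ell)\ge x_\ell$; 5. $x_\ell+z_\ell>\frac1{4c_2}$, $\ y_r\ge\sqrt{\frac{x_\ell+z_\ell}{c_2}}-(x_\ell+z_\ell)>0$, $\ \sqrt{\frac{x_r+z_r}{c_2}}-(x_r+z_r)\ge y_\ell>0$.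 Let $\mathcal R=[x_\ell,x_r]\times[y_\ell,y_r]\times[z_\ell,z_r]\subset\mathbb R^3$ and let $\widetilde{\mathcal R}=(\mathcal R,\mathcal R^-)$ be the oriented parallelepiped with $\mathcal R^-=\mathcal R^-_\ell\cup\mathcal R^-_r$, where $\mathcal R^-_\ell=[x_\ell,x_r]\times[y_\ell,y_r]\times\{z_\ell\}$ and $\mathcal R^-_r=[x_\ell,x_r]\times[y_\ell,y_r]\times\{z_r\}$. Then there exist two disjoint compact subsets $\mathcal K_0,\mathcal K_1$ of $\mathcal R$ such that, for each $i\in\{0,1\}$, $(\mathcal K_i,F)$ stretches $\widetilde{\mathcal R}$ to $\widetilde{\mathcal R}$ along the paths. Hence $F$ induces chaotic dynamics on two symbols on $\mathcal R$ relatively to $\mathcal K_0$ and $\mathcal K_1$.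
   Context: **Stretching along the paths.** Let $X$ be a metric space. A generalized parallelepiped is a set $\mathcal P\subseteq X$ together with a homeomorphism $h:[0,1]^3\to\mathcal P$; its left and right faces are $\mathcal P^-_\ell=h(\{x_3=0\})$ and $\mathcal P^-_r=h(\{x_3=1\})$. With $\mathcal P^-=\mathcal P^-_\ell\cup\mathcal P^-_r$, the pair $\widetilde{\mathcal P}=(\mathcal P,\mathcal P^-)$ is called an oriented parallelepiped. A path is a continuous map from a compact interval. Let $\widetilde{\mathcal A}=(\mathcal A,\mathcal A^-)$ and $\widetilde{\mathcal B}=(\mathcal B,\mathcal B^-)$ be oriented parallelepipeds of $X$, let $\psi:\mathcal A\to X$ be a function and let $\mathcal K\subseteq\mathcal A$ be compact. We say that $(\mathcal K,\psi)$ stretches $\widetilde{\mathcal A}$ to $\widetilde{\mathcal B}$ along the paths if: - $\psi$ is continuous on $\mathcal K$; - for every path $\gamma:[0,1]\to\mathcal A$ with $\gamma(0)$ and $\gamma(1)$ in different components of $\mathcal A^-$ (one in $\mathcal A^-_\ell$, the other in $\mathcal A^-_r$), there is a subinterval $[t',t'']\subseteq[0,1]$ such that $\gamma(t)\in\mathcal K$ and $\psi(\gamma(t))\in\mathcal B$ for all $t\in[t',t'']$, and $\psi(\gamma(t'))$ and $\psi(\gamma(t''))$ belong to different components of $\mathcal B^-$ (one to $\mathcal B^-_\ell$, the other to $\mathcal B^-_r$). **Chaotic dynamics on two symbols.** Let $X$ be a metric space, $\psi:X\supseteq\mathcal D\to X$ a function, and $\mathcal K_0,\mathcal K_1$ nonempty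 disjoint compact subsets of $\mathcal D$. Set $\mathcal K=\mathcal K_0\cup\mathcal K_1$ and $\mathcal I_\infty=\bigcap_{n=0}^\infty\psi^{-n}(\mathcal K)$ (the points all of whose forward iterates under $\psi$ are defined and lie in $\mathcal K$). We say that $\psi$ induces chaotic dynamics on two symbols on $\mathcal D$ relatively to $\mathcal K_0,\mathcal K_1$ if $\mathcal I_\infty$ is a nonempty compact set and there exists a nonempty compact set $\mathcal I\subseteq\mathcal I_\infty\subseteq\mathcal K$ such that: (i) $\psi(\mathcal I)=\mathcal I$; (ii) $\psi|_{\mathcal I}$ is semi-conjugate to the Bernoulli shift on two symbols: there is a continuous map $\pi:\mathcal I\to\Sigma_2^+$ with $\pi\circ\psi|_{\mathcal I}=\sigma\circ\pi$. Here $\Sigma_2^+=\{0,1\}^{\mathbb N}$ carries the metric $\hat d(\mathbf s',\mathbf s'')=\sum_{i\in\mathbb N}d(s'_i,s''_i)/2^{i+1}$ ($d$ the discrete distance on $\{0,1\}$), and $\sigma((s_i)_i)=(s_{i+1})_i$; (iii) the set of periodic points of $\psi|_{\mathcal I_\infty}$ is dense in $\mathcal I$, and for every $k$-periodic sequence $\mathbf s\in\Sigma_2^+$ the preimage $\pi^{-1}(\mathbf s)\subseteq\mathcal I$ contains at least one $k$-periodic point of $\psi$. In the claim this is applied with $X=\mathbb R^3$, $\mathcal D=\mathcal R$ and $\psi=F|_{\mathcal R}$. *)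

theory Defs
  imports "HOL-Analysis.Analysis"
begin

section \<open>Oriented parallelepipeds and stretching along the paths\<close>

text \<open>
  An oriented parallelepiped is encoded as the triple of the set \<open>P\<close>, its left face and its
  right face; the set called \<open>P\<^sup>-\<close> in the literature is the (disjoint) union of the two faces.
\<close>

type_synonym 'a oriented_set = "'a set \<times> 'a set \<times> 'a set"

fun oriented_parallelepiped :: "'a::metric_space oriented_set \<Rightarrow> bool" where
  "oriented_parallelepiped (P, Pl, Pr) \<longleftrightarrow>
     (\<exists>(h :: real \<times> real \<times> real \<Rightarrow> 'a) g.
        homeomorphism ({0..1} \<times> {0..1} \<times> {0..1}) P h g \<and>
        Pl = h ` ({0..1} \<times> {0..1} \<times> {0}) \<and>
        Pr = h ` ({0..1} \<times> {0..1} \<times> {1}))"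

definition opposite_faces :: "'a set \<Rightarrow> 'a set \<Rightarrow> 'a \<Rightarrow> 'a \<Rightarrow> bool" where
  "opposite_faces L R p q \<longleftrightarrow> p \<in> L \<and> q \<in> R \<or> p \<in> R \<and> q \<in> L"

text \<open>
  The first three conjuncts are the standing assumptions on the data. Only the values of
  \<open>\<psi>\<close> on \<open>K\<close> matter, so \<open>\<psi>\<close> is given as a total function.
\<close>

fun stretches_along_paths ::
  "'a::metric_space set \<Rightarrow> ('a \<Rightarrow> 'a) \<Rightarrow> 'a oriented_set \<Rightarrow> 'a oriented_set \<Rightarrow> bool" where
  "stretches_along_paths K \<psi> (A, Al, Ar) (B, Bl, Br) \<longleftrightarrow>
     oriented_parallelepiped (A, Al, Ar) \<and> oriented_parallelepiped (B, Bl, Br) \<and>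
     compact K \<and> K \<subseteq> A \<and>
     continuous_on K \<psi> \<and>
     (\<forall>\<gamma>. path \<gamma> \<and> path_image \<gamma> \<subseteq> A \<and> opposite_faces Al Ar (\<gamma> 0) (\<gamma> 1) \<longrightarrow>
        (\<exists>t' t''. 0 \<le> t' \<and> t' < t'' \<and> t'' \<le> 1 \<and>
           (\<forall>t\<in>{t'..t''}. \<gamma> t \<in> K \<and> \<psi> (\<gamma> t) \<in> B) \<and>
           opposite_faces Bl Br (\<psi> (\<gamma> t')) (\<psi> (\<gamma> t''))))"


section \<open>The one-sided Bernoulli shift on two symbols\<close>

definition Sigma2 :: "(nat \<Rightarrow> nat) set" where
  "Sigma2 = UNIV \<rightarrow> {0, 1}"

definition dist_Sigma2 :: "(nat \<Rightarrow> nat) \<Rightarrow> (nat \<Rightarrow> nat) \<Rightarrow> real" where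
  "dist_Sigma2 s s' = (\<Sum>i. discrete_metric.dd (s i) (s' i) / 2 ^ (i + 1))"

definition shift :: "(nat \<Rightarrow> nat) \<Rightarrow> nat \<Rightarrow> nat" where
  "shift s = (\<lambda>i. s (i + 1))"

lemma summable_dist_Sigma2:
  "summable (\<lambda>i. discrete_metric.dd (s i) (s' i) / 2 ^ (i + 1))"
proof (rule summable_comparison_test')
  show "summable (\<lambda>i. (1 / 2 :: real) ^ i)"
    by (rule summable_geometric) simp
  show "norm (discrete_metric.dd (s i) (s' i) / 2 ^ (i + 1)) \<le> (1 / 2) ^ i" for i
    by (simp add: discrete_metric.dd_def field_simps power_one_over)
qed

lemma Metric_space_Sigma2: "Metric_space Sigma2 dist_Sigma2"
proof
  fix s t u :: "nat \<Rightarrow> nat"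
  show "0 \<le> dist_Sigma2 s t"
    unfolding dist_Sigma2_def
    by (intro suminf_nonneg summable_dist_Sigma2) (simp add: discrete_metric.dd_def)
  show "dist_Sigma2 s t = dist_Sigma2 t s"
    unfolding dist_Sigma2_def discrete_metric.dd_def by (simp add: eq_commute)
  show "dist_Sigma2 s t = 0 \<longleftrightarrow> s = t"
    unfolding dist_Sigma2_def
    by (subst suminf_eq_zero_iff[OF summable_dist_Sigma2])
       (auto simp: discrete_metric.dd_def fun_eq_iff)
  have "dist_Sigma2 s u \<le>
      (\<Sum>i. discrete_metric.dd (s i) (t i) / 2 ^ (i + 1) + discrete_metric.dd (t i) (u i) / 2 ^ (i + 1))"
    unfolding dist_Sigma2_def
    by (intro suminf_le summable_add summable_dist_Sigma2)
       (auto simp: discrete_metric.dd_def field_simps)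
  also have "\<dots> = dist_Sigma2 s t + dist_Sigma2 t u"
    unfolding dist_Sigma2_def by (rule suminf_add[symmetric]) (rule summable_dist_Sigma2)+
  finally show "dist_Sigma2 s u \<le> dist_Sigma2 s t + dist_Sigma2 t u" .
qed

abbreviation Sigma2_topology :: "(nat \<Rightarrow> nat) topology" where
  "Sigma2_topology \<equiv> Metric_space.mtopology Sigma2 dist_Sigma2"


section \<open>Chaotic dynamics on two symbols\<close>

text \<open>
  For \<open>K\<close> inside the domain of \<open>\<psi>\<close>, membership of all earlier iterates in \<open>K\<close> already
  guarantees that the next iterate is defined.
\<close>

definition forward_invariant_part :: "('a \<Rightarrow> 'a) \<Rightarrow> 'a set \<Rightarrow> 'a set" where
  "forward_invariant_part \<psi> K = {w. \<forall>n. (\<psi> ^^ n) w \<in> K}"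

definition periodic_points :: "('a \<Rightarrow> 'a) \<Rightarrow> 'a set \<Rightarrow> 'a set" where
  "periodic_points \<psi> S = {w \<in> S. \<exists>k>0. (\<psi> ^^ k) w = w}"

definition dense_subset :: "'a::topological_space set \<Rightarrow> 'a set \<Rightarrow> bool" where
  "dense_subset P S \<longleftrightarrow> P \<subseteq> S \<and> S \<subseteq> closure P"

text \<open>
  A point or sequence is \<open>k\<close>-periodic (\<open>k > 0\<close>) if it is fixed by the \<open>k\<close>-th iterate;
  \<open>k\<close> need not be the least period. Surjectivity of \<open>\<pi>\<close> is not demanded separately:
  its image is compact and, by the last clause, contains the dense set of periodic sequences.
\<close>

definition chaotic_on_two_symbols ::
  "('a::metric_space \<Rightarrow> 'a) \<Rightarrow> 'a set \<Rightarrow> 'a set \<Rightarrow> 'a set \<Rightarrow> bool" where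
  "chaotic_on_two_symbols \<psi> D K0 K1 \<longleftrightarrow>
     K0 \<noteq> {} \<and> K1 \<noteq> {} \<and> compact K0 \<and> compact K1 \<and> K0 \<inter> K1 = {} \<and> K0 \<subseteq> D \<and> K1 \<subseteq> D \<and>
     (let I_inf = forward_invariant_part \<psi> (K0 \<union> K1) in
        I_inf \<noteq> {} \<and> compact I_inf \<and>
        (\<exists>I. I \<noteq> {} \<and> compact I \<and> I \<subseteq> I_inf \<and>
           \<psi> ` I = I \<and>
           (\<exists>\<pi>. continuous_map (top_of_set I) Sigma2_topology \<pi> \<and>
                (\<forall>w\<in>I. \<pi> (\<psi> w) = shift (\<pi> w)) \<and>
                dense_subset (periodic_points \<psi> I_inf) I \<and>
                (\<forall>k>0. \<forall>s\<in>Sigma2. (shift ^^ k) s = s \<longrightarrow>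
                   (\<exists>w\<in>I. \<pi> w = s \<and> (\<psi> ^^ k) w = w)))))"


section \<open>The map\<close>

text \<open>
  The map is intended on \<open>x, y, z \<ge> 0\<close>, \<open>x + y + z > 0\<close> only; its values elsewhere are irrelevant.
\<close>

definition triopoly_map ::
  "real \<Rightarrow> real \<Rightarrow> real \<Rightarrow> real \<Rightarrow> real \<times> real \<times> real \<Rightarrow> real \<times> real \<times> real" where
  "triopoly_map c1 c2 c3 \<alpha> = (\<lambda>(x, y, z).
     ((2 * x + y + z - c1 * (x + y + z)\<^sup>2) / 2,
      sqrt ((x + z) / c2) - x - z,
      z + \<alpha> * z * (- c3 + (x + y) / (x + y + z)\<^sup>2)))"

end

theory Submission
  imports Defs
begin

text \<open>
  The plane \<open>z = z\<^sub>r / 2\<close> cuts the box into two strips. The conditions give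
  \<open>F\<^sub>3 = 0\<close> at \<open>z = 0\<close>, \<open>F\<^sub>3 \<le> 0\<close> at \<open>z = z\<^sub>r\<close> and \<open>F\<^sub>3 > z\<^sub>r\<close> at \<open>z = z\<^sub>r / 2\<close>, while \<open>F\<^sub>1\<close> and \<open>F\<^sub>2\<close> map the
  whole box into \<open>[x\<^sub>\<ell>, x\<^sub>r]\<close> and \<open>[y\<^sub>\<ell>, y\<^sub>r]\<close>. So \<open>K\<^sub>0\<close> and \<open>K\<^sub>1\<close>, the points of the lower and the upper
  strip that \<open>F\<close> sends back into the box, are disjoint, and stretching is the intermediate value theorem.

  A \<open>k\<close>-periodic point with prescribed itinerary is a solution of the cyclic system
  \<open>F w\<^sub>j = w\<^bsub>j+1 mod k\<^esub>\<close> with \<open>w\<^sub>j\<close> in the \<open>j\<close>-th strip. After a change of sign in some equations these are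
  \<open>3 k\<close> equations on a box of dimension \<open>3 k\<close> satisfying the Poincare-Miranda sign conditions. Since \<open>k\<close>
  varies, Brouwer's theorem for Euclidean types does not apply; the Poincare-Miranda theorem is instead
  derived for boxes of \<open>nat \<Rightarrow> real\<close> from Kuhn's combinatorial lemma. The invariant set \<open>I\<close> is
  the closure of the set of periodic points and \<open>\<pi>\<close> is the itinerary.
\<close>

section \<open>The Poincare-Miranda theorem\<close>

lemma compact_Pi_UNIV:
  fixes C :: "'i \<Rightarrow> 'b::topological_space set"
  assumes "\<And>i. compact (C i)"
  shows "compact (Pi UNIV C)"
proof -
  have "compactin (product_topology (\<lambda>i. euclidean) UNIV) (PiE UNIV C)"
    using assms by (auto simp: compactin_PiE)
  then show ?thesis
    by (simp add: euclidean_product_topology PiE_UNIV_domain)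
qed

lemma tendsto_fun_iff:
  fixes u :: "'c \<Rightarrow> 'i \<Rightarrow> 'b::topological_space"
  shows "(u \<longlongrightarrow> l) G \<longleftrightarrow> (\<forall>i. ((\<lambda>c. u c i) \<longlongrightarrow> l i) G)"
  using limitin_componentwise[of "\<lambda>i. euclidean" UNIV u l G]
  by (simp add: euclidean_product_topology)

text \<open>
  All coordinates of the box are kept, so that it is a compact product, but only the first \<open>n\<close> carry an
  equation.
\<close>

lemma poincare_miranda_approx:
  fixes a b :: "nat \<Rightarrow> real" and f :: "nat \<Rightarrow> (nat \<Rightarrow> real) \<Rightarrow> real" and p :: nat
  defines "B \<equiv> Pi UNIV (\<lambda>i. {a i..b i})"
  assumes p: "p > 0" and ab: "\<And>i. a i \<le> b i"
    and lower: "\<And>i x. i < n \<Longrightarrow> x \<in> B \<Longrightarrow> x i = a i \<Longrightarrow> f i x \<le> 0"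
    and upper: "\<And>i x. i < n \<Longrightarrow> x \<in> B \<Longrightarrow> x i = b i \<Longrightarrow> f i x \<ge> 0"
  shows "\<exists>u\<in>B. \<forall>i<n. \<exists>v\<in>B. \<exists>w\<in>B. f i v \<le> 0 \<and> f i w \<ge> 0 \<and>
      (\<forall>j. \<bar>v j - u j\<bar> \<le> (b j - a j) / p \<and> \<bar>w j - u j\<bar> \<le> (b j - a j) / p)"
proof -
  define g where "g r = (\<lambda>j. if j < n then a j + real (r j) / real p * (b j - a j) else a j)"
    for r :: "nat \<Rightarrow> nat"
  have g_B: "g r \<in> B" if "\<forall>j<n. r j \<le> p" for r
  proof -
    have "real (r j) / real p * (b j - a j) \<le> b j - a j" if "j < n" for j
      using that \<open>\<forall>j<n. r j \<le> p\<close> p ab[of j] by (intro mult_left_le_one_le) auto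
    then show ?thesis
      using ab by (force simp: B_def g_def)
  qed
  have close: "\<bar>g r j - g q j\<bar> \<le> (b j - a j) / p" if "\<forall>j<n. q j \<le> r j \<and> r j \<le> q j + 1" for q r j
  proof (cases "j < n")
    case True
    have "g r j - g q j = (real (r j) - real (q j)) * ((b j - a j) / p)"
      using True p by (simp add: g_def field_simps)
    also have "\<bar>\<dots>\<bar> = \<bar>real (r j) - real (q j)\<bar> * ((b j - a j) / p)"
      using ab[of j] by (simp add: abs_mult)
    also have "\<dots> \<le> (b j - a j) / p"
    proof (rule mult_left_le_one_le)
      show "\<bar>real (r j) - real (q j)\<bar> \<le> 1"
        using that True by fastforce
    qed (use ab[of j] in auto)
    finally show ?thesis .
  qed (use ab[of j] in \<open>simp add: g_def\<close>)
  \<comment> \<open>Kuhn's lemma demands label 0 on the lower faces and label 1 on the upper ones,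
    so there the label is forced; \<open>lower\<close> and \<open>upper\<close> keep it consistent
    with the sign of \<open>f i\<close>. Elsewhere the label records that sign.\<close>
  define label :: "(nat \<Rightarrow> nat) \<Rightarrow> nat \<Rightarrow> nat" where
    "label r i = (if r i = 0 \<or> r i \<noteq> p \<and> f i (g r) \<le> 0 then 0 else 1)" for r i
  have label0: "f i (g r) \<le> 0" if "label r i = 0" "\<forall>j<n. r j \<le> p" "i < n" for r i
    using that lower[of i "g r"] g_B[of r] by (auto simp: label_def g_def split: if_splits)
  have label1: "f i (g r) \<ge> 0" if "label r i = 1" "\<forall>j<n. r j \<le> p" "i < n" for r i
    using that upper[of i "g r"] g_B[of r] p by (auto simp: label_def g_def split: if_splits)
  \<comment> \<open>The small cube at \<open>q\<close> has, for every \<open>i\<close>, two corners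
    with different \<open>i\<close>-th labels, that is, corners where \<open>f i\<close> has
    opposite weak signs.\<close>
  obtain q where q: "\<forall>i<n. q i < p" and
    adj: "\<forall>i<n. \<exists>r s. (\<forall>j<n. q j \<le> r j \<and> r j \<le> q j + 1) \<and>
       (\<forall>j<n. q j \<le> s j \<and> s j \<le> q j + 1) \<and> label r i \<noteq> label s i"
    by (rule kuhn_lemma[of p n label]) (use p in \<open>auto simp: label_def\<close>)
  show ?thesis
  proof (rule bexI[of _ "g q"], intro allI impI)
    fix i assume "i < n"
    have sym: "\<exists>r s. (\<forall>j<n. q j \<le> r j \<and> r j \<le> q j + 1) \<and>
       (\<forall>j<n. q j \<le> s j \<and> s j \<le> q j + 1) \<and> label r i = 0 \<and> label s i = 1"
    proof -
      have *: "label r i = 0 \<or> label r i = 1" for r by (simp add: label_def)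
      from adj \<open>i < n\<close> obtain r s where "\<forall>j<n. q j \<le> r j \<and> r j \<le> q j + 1"
        "\<forall>j<n. q j \<le> s j \<and> s j \<le> q j + 1" "label r i \<noteq> label s i" by blast
      then show ?thesis using *[of r] *[of s] by metis
    qed
    then obtain r s where r: "\<forall>j<n. q j \<le> r j \<and> r j \<le> q j + 1" "label r i = 0"
      and s: "\<forall>j<n. q j \<le> s j \<and> s j \<le> q j + 1" "label s i = 1" by blast
    have "\<forall>j<n. r j \<le> p" "\<forall>j<n. s j \<le> p"
      using q r(1) s(1) by fastforce+
    with q r s show "\<exists>v\<in>B. \<exists>w\<in>B. f i v \<le> 0 \<and> f i w \<ge> 0 \<and>
      (\<forall>j. \<bar>v j - g q j\<bar> \<le> (b j - a j) / p \<and> \<bar>w j - g q j\<bar> \<le> (b j - a j) / p)"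
      by (intro bexI[of _ "g r"] bexI[of _ "g s"] conjI allI close label0 label1 g_B \<open>i < n\<close>) auto
  qed (use q in \<open>auto intro: g_B less_imp_le\<close>)
qed

text \<open>Refining the grid gives points \<open>u m\<close>, each close to a point where
  \<open>f i\<close> is nonpositive and to one where it is nonnegative. Along a convergent
  subsequence all three share their limit, and by continuity both weak inequalities hold
  there.\<close>

theorem poincare_miranda:
  fixes a b :: "nat \<Rightarrow> real" and f :: "nat \<Rightarrow> (nat \<Rightarrow> real) \<Rightarrow> real"
  defines "B \<equiv> Pi UNIV (\<lambda>i. {a i..b i})"
  assumes ab: "\<And>i. a i \<le> b i"
    and cont: "\<And>i. i < n \<Longrightarrow> continuous_on B (f i)"
    and lower: "\<And>i x. i < n \<Longrightarrow> x \<in> B \<Longrightarrow> x i = a i \<Longrightarrow> f i x \<le> 0"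
    and upper: "\<And>i x. i < n \<Longrightarrow> x \<in> B \<Longrightarrow> x i = b i \<Longrightarrow> f i x \<ge> 0"
  shows "\<exists>x\<in>B. \<forall>i<n. f i x = 0"
proof -
  have "\<forall>m. \<exists>u\<in>B. \<forall>i<n. \<exists>v\<in>B. \<exists>w\<in>B. f i v \<le> 0 \<and> f i w \<ge> 0 \<and>
      (\<forall>j. \<bar>v j - u j\<bar> \<le> (b j - a j) / real (Suc m) \<and> \<bar>w j - u j\<bar> \<le> (b j - a j) / real (Suc m))"
  proof
    fix m
    show "\<exists>u\<in>B. \<forall>i<n. \<exists>v\<in>B. \<exists>w\<in>B. f i v \<le> 0 \<and> f i w \<ge> 0 \<and>
      (\<forall>j. \<bar>v j - u j\<bar> \<le> (b j - a j) / real (Suc m) \<and> \<bar>w j - u j\<bar> \<le> (b j - a j) / real (Suc m))"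
      unfolding B_def
      by (rule poincare_miranda_approx) (use ab lower upper in \<open>auto simp: B_def\<close>)
  qed
  then obtain u where uB: "\<And>m. u m \<in> B" and
    uvw: "\<And>m i. i < n \<Longrightarrow> \<exists>v\<in>B. \<exists>w\<in>B. f i v \<le> 0 \<and> f i w \<ge> 0 \<and>
      (\<forall>j. \<bar>v j - u m j\<bar> \<le> (b j - a j) / real (Suc m) \<and> \<bar>w j - u m j\<bar> \<le> (b j - a j) / real (Suc m))"
    by metis
  have "compact B"
    unfolding B_def by (intro compact_Pi_UNIV) simp
  then obtain x \<sigma> where x: "x \<in> B" and \<sigma>: "strict_mono \<sigma>" and lim: "(u \<circ> \<sigma>) \<longlonglongrightarrow> x"
    using uB by (metis compact_imp_seq_compact seq_compactE)
  have conv: "(v \<circ> \<sigma>) \<longlonglongrightarrow> x"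
    if "\<And>m j. \<bar>v m j - u m j\<bar> \<le> (b j - a j) / real (Suc m)" for v
    unfolding tendsto_fun_iff
  proof
    fix j
    have "(\<lambda>m. (b j - a j) * inverse (real (Suc m))) \<longlonglongrightarrow> (b j - a j) * 0"
      by (intro tendsto_intros LIMSEQ_inverse_real_of_nat)
    then have "(\<lambda>m. (b j - a j) / real (Suc m)) \<longlonglongrightarrow> 0"
      by (simp add: divide_inverse)
    then have "(\<lambda>m. v m j - u m j) \<longlonglongrightarrow> 0"
      by (rule Lim_null_comparison[rotated]) (use that in auto)
    then have "(\<lambda>m. v (\<sigma> m) j - u (\<sigma> m) j) \<longlonglongrightarrow> 0"
      using \<sigma> by (auto dest: LIMSEQ_subseq_LIMSEQ simp: o_def)
    moreover have "(\<lambda>m. u (\<sigma> m) j) \<longlonglongrightarrow> x j"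
      using lim by (simp add: tendsto_fun_iff)
    ultimately show "(\<lambda>m. (v \<circ> \<sigma>) m j) \<longlonglongrightarrow> x j"
      using tendsto_add[of "\<lambda>m. v (\<sigma> m) j - u (\<sigma> m) j"] by fastforce
  qed
  have "f i x = 0" if i: "i < n" for i
  proof -
    obtain v w where v: "\<And>m. v m \<in> B" "\<And>m. f i (v m) \<le> 0"
        "\<And>m j. \<bar>v m j - u m j\<bar> \<le> (b j - a j) / real (Suc m)"
      and w: "\<And>m. w m \<in> B" "\<And>m. f i (w m) \<ge> 0"
        "\<And>m j. \<bar>w m j - u m j\<bar> \<le> (b j - a j) / real (Suc m)"
      using uvw[OF i] by metis
    have "(f i \<circ> (v \<circ> \<sigma>)) \<longlonglongrightarrow> f i x" "(f i \<circ> (w \<circ> \<sigma>)) \<longlonglongrightarrow> f i x"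
      using cont[OF i] x v w conv[of v] conv[of w]
      unfolding continuous_on_sequentially by (auto simp: o_def)
    then show ?thesis
      using v(2) w(2) by (intro antisym) (auto intro: LIMSEQ_le_const LIMSEQ_le_const2 simp: o_def)
  qed
  then show ?thesis using x by blast
qed

section \<open>Crossing strips\<close>

text \<open>The disjunction stands outside the quantifiers over \<open>X\<close> and
  \<open>Y\<close>: the third component of \<open>F\<close> crosses \<open>{c..d}\<close> between
  the heights \<open>l\<close> and \<open>r\<close> in the same direction over the whole base. This
  gives each strip a single sign.\<close>

definition strip_crossing ::
  "(real \<times> real \<times> real \<Rightarrow> real \<times> real \<times> real) \<Rightarrow> real set \<Rightarrow> real set \<Rightarrow> real \<Rightarrow> real \<Rightarrow> real \<Rightarrow> real \<Rightarrow> bool"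
  where "strip_crossing F X Y c d l r \<longleftrightarrow>
    (\<forall>x\<in>X. \<forall>y\<in>Y. snd (snd (F (x, y, l))) \<le> c \<and> d \<le> snd (snd (F (x, y, r)))) \<or>
    (\<forall>x\<in>X. \<forall>y\<in>Y. d \<le> snd (snd (F (x, y, l))) \<and> snd (snd (F (x, y, r))) \<le> c)"

text \<open>The coordinates of all \<open>k\<close> points form one vector with \<open>3 * k\<close>
  relevant entries, to which the Poincare-Miranda theorem applies. The first two components of
  \<open>F\<close> stay within the base; the third crosses all of \<open>{c..d}\<close> between the
  faces of a strip, in particular the height of the next point.\<close>

lemma strip_crossing_cyclic_orbit:
  fixes F :: "real \<times> real \<times> real \<Rightarrow> real \<times> real \<times> real" and x0 x1 y0 y1 c d :: real
    and l r :: "nat \<Rightarrow> real" and k :: nat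
  defines "S \<equiv> \<lambda>j. {x0..x1} \<times> {y0..y1} \<times> {l j..r j}"
  assumes k: "k > 0" and box: "x0 \<le> x1" "y0 \<le> y1" "\<And>j. c \<le> l j" "\<And>j. l j \<le> r j" "\<And>j. r j \<le> d"
    and cont: "\<And>j. continuous_on (S j) F"
    and F12: "\<And>j w. w \<in> S j \<Longrightarrow> fst (F w) \<in> {x0..x1} \<and> fst (snd (F w)) \<in> {y0..y1}"
    and cross: "\<And>j. strip_crossing F {x0..x1} {y0..y1} c d (l j) (r j)"
  shows "\<exists>w. \<forall>j<k. w j \<in> S j \<and> F (w j) = w (Suc j mod k)"
proof -
  \<comment> \<open>Cyclic predecessor modulo \<open>k\<close>, with \<open>0\<close> wrapping to
    \<open>k - 1\<close>.\<close>
  define prev where "prev j = (if j = 0 then k - 1 else j - 1)" for j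
  have prev: "prev (Suc j mod k) = j" if "j < k" for j
    using that by (cases "Suc j = k") (auto simp: prev_def)
  \<comment> \<open>Three consecutive entries of the long vector are read as one point of space;
    \<open>a\<close> and \<open>b\<close> list the bounds of the strips in the same order.\<close>
  define W where "W j x = (x (3 * j), x (3 * j + 1), x (3 * j + 2))" for j and x :: "nat \<Rightarrow> real"
  define a where "a i = (if i mod 3 = 0 then x0 else if i mod 3 = 1 then y0 else l (i div 3))" for i
  define b where "b i = (if i mod 3 = 0 then x1 else if i mod 3 = 1 then y1 else r (i div 3))" for i
  define B where "B = Pi UNIV (\<lambda>i. {a i..b i})"
  \<comment> \<open>\<open>e j\<close> records the direction of the crossing; as a factor it makes
    the third equation nonpositive on the lower face and nonnegative on the upper one.\<close>
  define e :: "nat \<Rightarrow> real" where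
    "e j = (if \<forall>x\<in>{x0..x1}. \<forall>y\<in>{y0..y1}.
        snd (snd (F (x, y, l j))) \<le> c \<and> d \<le> snd (snd (F (x, y, r j))) then 1 else -1)" for j
  \<comment> \<open>The sign conditions pair an equation with a coordinate: the equations for the first two components of
    \<open>F w\<^sub>j\<close> belong to the coordinates of \<open>w\<^bsub>j+1\<^esub>\<close>, the one for the third to the last coordinate of \<open>w\<^sub>j\<close>.\<close>
  define f where "f i x =
    (if i mod 3 = 0 then x i - fst (F (W (prev (i div 3)) x))
     else if i mod 3 = 1 then x i - fst (snd (F (W (prev (i div 3)) x)))
     else e (i div 3) * (snd (snd (F (W (i div 3) x))) - x (3 * (Suc (i div 3) mod k) + 2)))" for i x
  have ab: "a i \<le> b i" for i
    using box by (simp add: a_def b_def)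
  have dm: "3 * j mod 3 = 0" "3 * j div 3 = j" "(3 * j + 1) mod 3 = 1" "(3 * j + 1) div 3 = j"
    "(3 * j + 2) mod 3 = 2" "(3 * j + 2) div 3 = j" for j :: nat
    by presburger+
  have nth: "a (3 * j) = x0" "b (3 * j) = x1" "a (3 * j + 1) = y0" "b (3 * j + 1) = y1"
    "a (3 * j + 2) = l j" "b (3 * j + 2) = r j" for j
    unfolding a_def b_def dm by simp_all
  have W: "W j x \<in> S j" if "x \<in> B" for j x
  proof -
    have "x i \<in> {a i..b i}" for i using that by (auto simp: B_def)
    from this[of "3 * j"] this[of "3 * j + 1"] this[of "3 * j + 2"] show ?thesis
      unfolding nth by (simp add: W_def S_def)
  qed
  have z_range: "c \<le> x (3 * j + 2) \<and> x (3 * j + 2) \<le> d" if "x \<in> B" for j x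
    using W[OF that, of j] box(3)[of j] box(5)[of j] by (auto simp: W_def S_def)
  have contW: "continuous_on B (\<lambda>x. F (W j x))" for j
  proof (rule continuous_on_compose2[OF cont])
    show "continuous_on B (W j)"
      unfolding W_def
      by (intro continuous_on_Pair) (auto intro: continuous_on_subset[OF continuous_on_product_coordinates])
  qed (use W in auto)
  have coord: "continuous_on B (\<lambda>x. x i)" for i
    by (auto intro: continuous_on_subset[OF continuous_on_product_coordinates])
  have contf: "continuous_on B (f i)" for i
    unfolding f_def
    by (cases "i mod 3 = 0"; cases "i mod 3 = 1") (auto intro!: continuous_intros contW coord)
  have sides: "(x i = a i \<longrightarrow> f i x \<le> 0) \<and> (x i = b i \<longrightarrow> f i x \<ge> 0)" if "x \<in> B" for i x
  proof -
    consider "i mod 3 = 0" | "i mod 3 = 1" | "i mod 3 = 2" by linarith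
    then show ?thesis
    proof cases
      case 3
      define j where "j = i div 3"
      have i: "i = 3 * j + 2" using 3 by (simp add: j_def) presburger
      \<comment> \<open>The height required of the image, namely that of the cyclically next point.
        It lies in \<open>{c..d}\<close>, hence weakly between the values of the third component of
        \<open>F\<close> on the two faces.\<close>
      define z where "z = x (3 * (Suc j mod k) + 2)"
      have z: "c \<le> z" "z \<le> d"
        using z_range[OF that] by (auto simp: z_def)
      have fi: "f i x = e j * (snd (snd (F (x (3 * j), x (3 * j + 1), x i))) - z)"
        unfolding f_def by (simp only: 3 i dm W_def z_def) simp
      have face: "a i = l j" "b i = r j"
        unfolding i by (rule nth)+
      have xy: "x (3 * j) \<in> {x0..x1}" "x (3 * j + 1) \<in> {y0..y1}"
        using W[OF that, of j] by (auto simp: W_def S_def)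
      show ?thesis
      proof (cases "e j = 1")
        case True
        then have "\<forall>x\<in>{x0..x1}. \<forall>y\<in>{y0..y1}.
            snd (snd (F (x, y, l j))) \<le> c \<and> d \<le> snd (snd (F (x, y, r j)))"
          unfolding e_def by (auto split: if_splits)
        with xy have "snd (snd (F (x (3 * j), x (3 * j + 1), l j))) \<le> c"
          "d \<le> snd (snd (F (x (3 * j), x (3 * j + 1), r j)))" by blast+
        with True z show ?thesis
          unfolding fi face by auto
      next
        case False
        then have ej: "e j = -1" by (simp add: e_def split: if_splits)
        with cross[of j] have "\<forall>x\<in>{x0..x1}. \<forall>y\<in>{y0..y1}.
            d \<le> snd (snd (F (x, y, l j))) \<and> snd (snd (F (x, y, r j))) \<le> c"
          unfolding e_def strip_crossing_def by (auto split: if_splits)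
        with xy have "d \<le> snd (snd (F (x (3 * j), x (3 * j + 1), l j)))"
          "snd (snd (F (x (3 * j), x (3 * j + 1), r j))) \<le> c" by blast+
        with ej z show ?thesis
          unfolding fi face by auto
      qed
    qed (use F12[OF W[OF that]] in \<open>auto simp: f_def a_def b_def\<close>)
  qed
  have "\<exists>x\<in>B. \<forall>i<3 * k. f i x = 0"
    unfolding B_def by (rule poincare_miranda) (use ab contf sides in \<open>auto simp: B_def\<close>)
  then obtain x where x: "x \<in> B" and zero: "\<And>i. i < 3 * k \<Longrightarrow> f i x = 0" by blast
  have "F (W j x) = W (Suc j mod k) x" if j: "j < k" for j
  proof -
    define j' where "j' = Suc j mod k"
    have j': "j' < k" "prev j' = j" using k prev[OF j] by (auto simp: j'_def)
    have "f (3 * j') x = 0" "f (3 * j' + 1) x = 0" "f (3 * j + 2) x = 0"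
      using j j'(1) by (auto intro!: zero)
    moreover have "e j \<noteq> 0" by (simp add: e_def)
    ultimately have "fst (F (W j x)) = x (3 * j')" "fst (snd (F (W j x))) = x (3 * j' + 1)"
      "snd (snd (F (W j x))) = x (3 * j' + 2)"
      unfolding f_def dm j' by (auto simp: j'_def)
    then show ?thesis
      unfolding j'_def[symmetric] W_def[of j'] by (metis prod.collapse)
  qed
  then show ?thesis using W[OF x] by (intro exI[of _ "\<lambda>j. W j x"]) blast
qed

section \<open>Stretching of paths that cross a strip\<close>

lemma first_last_crossing:
  fixes \<phi> :: "real \<Rightarrow> real"
  assumes ab: "a \<le> b" and cont: "continuous_on {a..b} \<phi>" and "c < d" "\<phi> a \<le> c" "d \<le> \<phi> b"
  shows "\<exists>s t. a \<le> s \<and> s < t \<and> t \<le> b \<and> \<phi> s = c \<and> \<phi> t = d \<and> (\<forall>u\<in>{s..t}. \<phi> u \<in> {c..d})"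
proof -
  have ivt: "\<exists>u\<in>{v..w}. \<phi> u = y" if "\<phi> v \<le> y" "y \<le> \<phi> w" "v \<le> w" "a \<le> v" "w \<le> b" for v w y
    using IVT'[of \<phi> v y w] continuous_on_subset[OF cont, of "{v..w}"] that by auto
  have level: "compact {u \<in> {v..w}. \<phi> u = y}" if "a \<le> v" "w \<le> b" for v w y
  proof -
    have "closed {u \<in> {v..w}. \<phi> u = y}"
      by (rule continuous_closed_preimage_constant)
         (use that in \<open>auto intro: continuous_on_subset[OF cont]\<close>)
    with compact_Icc have "compact ({v..w} \<inter> {u \<in> {v..w}. \<phi> u = y})"
      by (rule compact_Int_closed)
    moreover have "{v..w} \<inter> {u \<in> {v..w}. \<phi> u = y} = {u \<in> {v..w}. \<phi> u = y}" by auto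
    ultimately show ?thesis by simp
  qed
  \<comment> \<open>\<open>t\<close> is the first time at level \<open>d\<close>, and
    \<open>s\<close> the last time up to \<open>t\<close> at level \<open>c\<close>. Leaving
    \<open>{c..d}\<close> between them would, by the intermediate value theorem, force an earlier
    \<open>t\<close> or a later \<open>s\<close>.\<close>
  obtain t where t: "t \<in> {a..b}" "\<phi> t = d" and t_min: "\<And>u. u \<in> {a..b} \<Longrightarrow> \<phi> u = d \<Longrightarrow> t \<le> u"
    using compact_attains_inf[OF level[of a b d]] ivt[of a d b] assms by fastforce
  obtain s where s: "s \<in> {a..t}" "\<phi> s = c" and s_max: "\<And>u. u \<in> {a..t} \<Longrightarrow> \<phi> u = c \<Longrightarrow> u \<le> s"
    using compact_attains_sup[OF level[of a t c]] ivt[of a c t] assms t by fastforce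
  have "\<phi> u \<in> {c..d}" if u: "u \<in> {s..t}" for u
  proof -
    have "\<phi> u \<le> d"
    proof (rule ccontr)
      assume "\<not> \<phi> u \<le> d"
      then obtain v where "v \<in> {s..u}" "\<phi> v = d"
        using ivt[of s d u] s t u \<open>c < d\<close> by auto
      with t_min[of v] s t u have "v = u" by auto
      with \<open>\<phi> v = d\<close> \<open>\<not> \<phi> u \<le> d\<close> show False by simp
    qed
    moreover have "c \<le> \<phi> u"
    proof (rule ccontr)
      assume "\<not> c \<le> \<phi> u"
      then obtain v where "v \<in> {u..t}" "\<phi> v = c"
        using ivt[of u c t] s t u \<open>c < d\<close> by auto
      with s_max[of v] s t u have "v = u" by auto
      with \<open>\<phi> v = c\<close> \<open>\<not> c \<le> \<phi> u\<close> show False by simp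
    qed
    ultimately show ?thesis by simp
  qed
  moreover have "s \<noteq> t" using s t \<open>c < d\<close> by auto
  ultimately show ?thesis using s t by (intro exI[of _ s] exI[of _ t]) auto
qed

text \<open>A descending crossing is an ascending one for \<open>- \<phi>\<close> with the levels
  \<open>- d\<close> and \<open>- c\<close>.\<close>

lemma interval_crossing:
  fixes \<phi> :: "real \<Rightarrow> real"
  assumes "a \<le> b" and cont: "continuous_on {a..b} \<phi>" and "c < d"
    and ends: "\<phi> a \<le> c \<and> d \<le> \<phi> b \<or> d \<le> \<phi> a \<and> \<phi> b \<le> c"
  shows "\<exists>s t. a \<le> s \<and> s < t \<and> t \<le> b \<and> (\<phi> s = c \<and> \<phi> t = d \<or> \<phi> s = d \<and> \<phi> t = c) \<and>
    (\<forall>u\<in>{s..t}. \<phi> u \<in> {c..d})"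
  using ends
proof
  assume "\<phi> a \<le> c \<and> d \<le> \<phi> b"
  then show ?thesis using first_last_crossing[OF assms(1-3)] by blast
next
  assume "d \<le> \<phi> a \<and> \<phi> b \<le> c"
  then obtain s t where "a \<le> s" "s < t" "t \<le> b" "- \<phi> s = - d" "- \<phi> t = - c"
    "\<forall>u\<in>{s..t}. - \<phi> u \<in> {- d..- c}"
    using first_last_crossing[of a b "\<lambda>u. - \<phi> u" "- d" "- c"] assms(1-3)
    by (auto intro: continuous_intros)
  then show ?thesis by (intro exI[of _ s] exI[of _ t]) auto
qed

lemma oriented_parallelepiped_box:
  fixes x0 x1 y0 y1 z0 z1 :: real
  assumes "x0 < x1" "y0 < y1" "z0 < z1"
  shows "oriented_parallelepiped ({x0..x1} \<times> {y0..y1} \<times> {z0..z1},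
    {x0..x1} \<times> {y0..y1} \<times> {z0}, {x0..x1} \<times> {y0..y1} \<times> {z1})"
proof -
  define h :: "real \<times> real \<times> real \<Rightarrow> real \<times> real \<times> real" where
    "h = (\<lambda>(x, y, z). (x0 + (x1 - x0) * x, y0 + (y1 - y0) * y, z0 + (z1 - z0) * z))"
  define g :: "real \<times> real \<times> real \<Rightarrow> real \<times> real \<times> real" where
    "g = (\<lambda>(x, y, z). ((x - x0) / (x1 - x0), (y - y0) / (y1 - y0), (z - z0) / (z1 - z0)))"
  have gh: "g (h p) = p" and hg: "h (g p) = p" for p
    using assms by (auto simp: g_def h_def split: prod.split)
  have unit: "u + (v - u) * t \<in> {u..v}" if "t \<in> {0..1}" "u < v" for t u v :: real
  proof -
    have "(v - u) * t \<le> v - u" "(v - u) * t \<ge> 0"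
      using that by (auto intro: mult_left_le)
    then show ?thesis by auto
  qed
  have rescale: "(t - u) / (v - u) \<in> {0..1}" if "t \<in> {u..v}" "u < v" for t u v :: real
    using that by auto
  \<comment> \<open>The third factors are left arbitrary, so that one argument covers the whole cube
    and both faces.\<close>
  have image: "h ` ({0..1} \<times> {0..1} \<times> C) = {x0..x1} \<times> {y0..y1} \<times> D"
    if "(\<lambda>z. z0 + (z1 - z0) * z) ` C \<subseteq> D" "(\<lambda>z. (z - z0) / (z1 - z0)) ` D \<subseteq> C" for C D
  proof (intro equalityI subsetI)
    fix p assume "p \<in> {x0..x1} \<times> {y0..y1} \<times> D"
    then have "g p \<in> {0..1} \<times> {0..1} \<times> C"
      using that(2) rescale[of _ x0 x1] rescale[of _ y0 y1] assms unfolding g_def by auto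
    then show "p \<in> h ` ({0..1} \<times> {0..1} \<times> C)"
      by (metis hg imageI)
  qed (use that(1) unit[of _ x0 x1] unit[of _ y0 y1] assms in \<open>auto simp: h_def\<close>)
  have cube: "h ` ({0..1} \<times> {0..1} \<times> {0..1}) = {x0..x1} \<times> {y0..y1} \<times> {z0..z1}"
    using unit[of _ z0 z1] rescale[of _ z0 z1] assms by (intro image) auto
  have "homeomorphism ({0..1} \<times> {0..1} \<times> {0..1}) ({x0..x1} \<times> {y0..y1} \<times> {z0..z1}) h g"
  proof (rule homeomorphismI)
    show "continuous_on ({0..1} \<times> {0..1} \<times> {0..1}) h"
      unfolding h_def case_prod_unfold by (intro continuous_intros)
    show "continuous_on ({x0..x1} \<times> {y0..y1} \<times> {z0..z1}) g"
      unfolding g_def case_prod_unfold using assms by (intro continuous_intros) auto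
    show "g ` ({x0..x1} \<times> {y0..y1} \<times> {z0..z1}) \<subseteq> {0..1} \<times> {0..1} \<times> {0..1}"
      unfolding cube[symmetric] by (auto simp: gh image_image)
  qed (use cube gh hg in auto)
  moreover have "{x0..x1} \<times> {y0..y1} \<times> {z0} = h ` ({0..1} \<times> {0..1} \<times> {0})"
    by (rule image[symmetric]) auto
  moreover have "{x0..x1} \<times> {y0..y1} \<times> {z1} = h ` ({0..1} \<times> {0..1} \<times> {1})"
    using assms by (intro image[symmetric]) auto
  ultimately show ?thesis by auto
qed

text \<open>Two successive crossings: the height along the path yields a piece that stays in the
  strip and joins its two faces; on this piece the third component of \<open>F\<close> crosses
  \<open>{c..d}\<close>, which yields the required subinterval.\<close>

lemma strip_crossing_stretches:
  fixes F :: "real \<times> real \<times> real \<Rightarrow> real \<times> real \<times> real" and x0 x1 y0 y1 c d l r :: real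
  defines "R \<equiv> {x0..x1} \<times> {y0..y1} \<times> {c..d}" and "S \<equiv> {x0..x1} \<times> {y0..y1} \<times> {l..r}"
  defines "Rl \<equiv> {x0..x1} \<times> {y0..y1} \<times> {c}" and "Rr \<equiv> {x0..x1} \<times> {y0..y1} \<times> {d}"
  assumes box: "x0 < x1" "y0 < y1" "c < d" and lr: "c \<le> l" "l < r" "r \<le> d"
    and cont: "continuous_on S F"
    and F12: "\<And>w. w \<in> S \<Longrightarrow> fst (F w) \<in> {x0..x1} \<and> fst (snd (F w)) \<in> {y0..y1}"
    and cross: "strip_crossing F {x0..x1} {y0..y1} c d l r"
  shows "stretches_along_paths {w \<in> S. F w \<in> R} F (R, Rl, Rr) (R, Rl, Rr)"
proof -
  have op: "oriented_parallelepiped (R, Rl, Rr)"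
    unfolding R_def Rl_def Rr_def using box by (rule oriented_parallelepiped_box)
  have S_R: "S \<subseteq> R" using lr by (auto simp: S_def R_def)
  have "compact S" "closed S" "closed R"
    by (auto simp: S_def R_def intro!: compact_Times closed_Times)
  then have "closed (S \<inter> F -` R)"
    using cont by (auto intro: continuous_closed_preimage)
  moreover have K: "{w \<in> S. F w \<in> R} = S \<inter> (S \<inter> F -` R)" by auto
  ultimately have "compact {w \<in> S. F w \<in> R}"
    using \<open>compact S\<close> by (simp only: compact_Int_closed)
  moreover have "\<exists>t' t''. 0 \<le> t' \<and> t' < t'' \<and> t'' \<le> 1 \<and>
      (\<forall>t\<in>{t'..t''}. \<gamma> t \<in> {w \<in> S. F w \<in> R} \<and> F (\<gamma> t) \<in> R) \<and>
      opposite_faces Rl Rr (F (\<gamma> t')) (F (\<gamma> t''))"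
    if \<gamma>: "path \<gamma>" "path_image \<gamma> \<subseteq> R" "opposite_faces Rl Rr (\<gamma> 0) (\<gamma> 1)" for \<gamma>
  proof -
    have \<gamma>_R: "\<gamma> t \<in> R" if "t \<in> {0..1}" for t
      using \<gamma>(2) that by (auto simp: path_image_def)
    have cont_\<gamma>: "continuous_on {0..1} \<gamma>" using \<gamma>(1) by (simp add: path_def)
    have "\<exists>a b. 0 \<le> a \<and> a < b \<and> b \<le> 1 \<and> (snd (snd (\<gamma> a)) = l \<and> snd (snd (\<gamma> b)) = r \<or>
        snd (snd (\<gamma> a)) = r \<and> snd (snd (\<gamma> b)) = l) \<and> (\<forall>u\<in>{a..b}. snd (snd (\<gamma> u)) \<in> {l..r})"
    proof (rule interval_crossing)
      show "continuous_on {0..1} (\<lambda>t. snd (snd (\<gamma> t)))"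
        by (intro continuous_intros cont_\<gamma>)
    qed (use \<gamma>(3) lr in \<open>auto simp: opposite_faces_def Rl_def Rr_def\<close>)
    then obtain a b where ab: "0 \<le> a" "a < b" "b \<le> 1"
      and ends: "snd (snd (\<gamma> a)) = l \<and> snd (snd (\<gamma> b)) = r \<or> snd (snd (\<gamma> a)) = r \<and> snd (snd (\<gamma> b)) = l"
      and between: "\<And>u. u \<in> {a..b} \<Longrightarrow> snd (snd (\<gamma> u)) \<in> {l..r}" by blast
    have \<gamma>_S: "\<gamma> u \<in> S" if "u \<in> {a..b}" for u
      using \<gamma>_R[of u] between[OF that] ab that by (auto simp: R_def S_def mem_Times_iff)
    have contF: "continuous_on {a..b} (\<lambda>u. F (\<gamma> u))"
    proof (rule continuous_on_compose2[OF cont])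
      show "continuous_on {a..b} \<gamma>" using ab by (auto intro: continuous_on_subset[OF cont_\<gamma>])
    qed (use \<gamma>_S in auto)
    have xy: "fst (\<gamma> u) \<in> {x0..x1}" "fst (snd (\<gamma> u)) \<in> {y0..y1}" if "u \<in> {a..b}" for u
      using \<gamma>_S[OF that] by (auto simp: S_def)
    have "\<exists>s t. a \<le> s \<and> s < t \<and> t \<le> b \<and> (snd (snd (F (\<gamma> s))) = c \<and> snd (snd (F (\<gamma> t))) = d \<or>
        snd (snd (F (\<gamma> s))) = d \<and> snd (snd (F (\<gamma> t))) = c) \<and> (\<forall>u\<in>{s..t}. snd (snd (F (\<gamma> u))) \<in> {c..d})"
    proof (rule interval_crossing)
      show "continuous_on {a..b} (\<lambda>t. snd (snd (F (\<gamma> t))))"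
        by (intro continuous_intros contF)
      have \<gamma>_eq: "\<gamma> u = (fst (\<gamma> u), fst (snd (\<gamma> u)), snd (snd (\<gamma> u)))" for u by simp
      show "snd (snd (F (\<gamma> a))) \<le> c \<and> d \<le> snd (snd (F (\<gamma> b))) \<or>
          d \<le> snd (snd (F (\<gamma> a))) \<and> snd (snd (F (\<gamma> b))) \<le> c"
        using cross ends xy[of a] xy[of b] ab unfolding strip_crossing_def
        by (metis \<gamma>_eq atLeastAtMost_iff less_imp_le order_refl)
    qed (use ab box in auto)
    then obtain s t where st: "a \<le> s" "s < t" "t \<le> b"
      and F_ends: "snd (snd (F (\<gamma> s))) = c \<and> snd (snd (F (\<gamma> t))) = d \<or>
        snd (snd (F (\<gamma> s))) = d \<and> snd (snd (F (\<gamma> t))) = c"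
      and F_between: "\<And>u. u \<in> {s..t} \<Longrightarrow> snd (snd (F (\<gamma> u))) \<in> {c..d}" by blast
    have "F (\<gamma> u) \<in> R" "\<gamma> u \<in> S" if "u \<in> {s..t}" for u
      using F_between[OF that] F12[OF \<gamma>_S[of u]] \<gamma>_S[of u] st that by (auto simp: R_def mem_Times_iff)
    moreover from this[of s] this[of t] F_ends st
    have "opposite_faces Rl Rr (F (\<gamma> s)) (F (\<gamma> t))"
      by (auto simp: opposite_faces_def R_def Rl_def Rr_def mem_Times_iff)
    ultimately show ?thesis
      using st ab by (intro exI[of _ s] exI[of _ t]) auto
  qed
  ultimately show ?thesis
    using op S_R continuous_on_subset[OF cont, of "{w \<in> S. F w \<in> R}"] by auto
qed

section \<open>Chaotic dynamics from periodic itineraries\<close>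

text \<open>Agreement on the first \<open>N\<close> symbols leaves only the tail of a geometric
  series. Hence continuity of an itinerary map can be checked on cylinders.\<close>

lemma dist_Sigma2_le:
  assumes "\<And>n. n < N \<Longrightarrow> s n = t n"
  shows "dist_Sigma2 s t \<le> (1 / 2) ^ N"
proof -
  let ?f = "\<lambda>n. discrete_metric.dd (s n) (t n) / 2 ^ (n + 1) :: real"
  have half: "(\<lambda>n. (1 / 2) ^ N * (1 / 2) ^ Suc n) sums ((1 / 2 :: real) ^ N * 1)"
    by (intro sums_mult power_half_series)
  have "dist_Sigma2 s t = (\<Sum>n. ?f (n + N)) + (\<Sum>n<N. ?f n)"
    unfolding dist_Sigma2_def by (rule suminf_split_initial_segment) (rule summable_dist_Sigma2)
  also have "(\<Sum>n<N. ?f n) = 0"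
    using assms by (intro sum.neutral) (auto simp: discrete_metric.dd_def)
  also have "(\<Sum>n. ?f (n + N)) \<le> (\<Sum>n. (1 / 2) ^ N * (1 / 2) ^ Suc n)"
  proof (rule suminf_le)
    show "summable (\<lambda>n. ?f (n + N))"
      by (rule summable_ignore_initial_segment) (rule summable_dist_Sigma2)
    show "summable (\<lambda>n. (1 / 2) ^ N * (1 / 2 :: real) ^ Suc n)"
      using half by (rule sums_summable)
    show "?f (n + N) \<le> (1 / 2) ^ N * (1 / 2) ^ Suc n" for n
      by (simp add: discrete_metric.dd_def power_add power_one_over mult_ac)
  qed
  also have "\<dots> = (1 / 2) ^ N"
    using half by (simp only: sums_iff)
  finally show ?thesis by simp
qed

lemma shift_funpow: "(shift ^^ k) s i = s (i + k)"
  by (induction k arbitrary: i) (auto simp: shift_def)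

text \<open>As \<open>\<psi>\<close> is continuous on \<open>K\<close> only, a limit point is
  followed one iterate at a time: convergence of the \<open>n\<close>-th iterates and membership of
  their limit in \<open>K\<close> are proved together, since membership is what allows the next use
  of continuity.\<close>

lemma compact_forward_invariant_part:
  fixes \<psi> :: "'a::metric_space \<Rightarrow> 'a"
  assumes "compact K" and cont: "continuous_on K \<psi>"
  shows "compact (forward_invariant_part \<psi> K)"
proof -
  have "closed (forward_invariant_part \<psi> K)"
    unfolding closed_sequential_limits
  proof (intro allI impI, elim conjE)
    fix u :: "nat \<Rightarrow> 'a" and l
    assume u: "\<forall>m. u m \<in> forward_invariant_part \<psi> K" and lim: "u \<longlonglongrightarrow> l"
    have orbit: "(\<psi> ^^ n) (u m) \<in> K" for m n
      using u by (auto simp: forward_invariant_part_def)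
    have "(\<lambda>m. (\<psi> ^^ n) (u m)) \<longlonglongrightarrow> (\<psi> ^^ n) l \<and> (\<psi> ^^ n) l \<in> K" for n
    proof (induction n)
      case 0
      show ?case
        using lim orbit[of 0] closed_sequentially[OF compact_imp_closed[OF \<open>compact K\<close>], of u l] by auto
    next
      case (Suc n)
      then have "(\<lambda>m. (\<psi> ^^ Suc n) (u m)) \<longlonglongrightarrow> (\<psi> ^^ Suc n) l"
        using cont orbit[of n] by (auto simp: continuous_on_sequentially o_def)
      then show ?case
        using closed_sequentially[OF compact_imp_closed[OF \<open>compact K\<close>], of "\<lambda>m. (\<psi> ^^ Suc n) (u m)"] orbit
      by blast
    qed
    then show "l \<in> forward_invariant_part \<psi> K"
      by (simp add: forward_invariant_part_def)
  qed
  moreover have "forward_invariant_part \<psi> K \<subseteq> K"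
    unfolding forward_invariant_part_def by (auto dest: spec[of _ 0])
  ultimately show ?thesis
    using compact_Int_closed[OF \<open>compact K\<close>] by (metis inf.absorb2)
qed

lemma forward_invariant_part_funpow:
  assumes "w \<in> forward_invariant_part \<psi> K"
  shows "(\<psi> ^^ n) w \<in> forward_invariant_part \<psi> K"
proof -
  have "(\<psi> ^^ m) ((\<psi> ^^ n) w) = (\<psi> ^^ (m + n)) w" for m
    by (simp add: funpow_add)
  then show ?thesis
    using assms by (simp add: forward_invariant_part_def)
qed

lemma continuous_on_funpow_forward_invariant_part:
  fixes \<psi> :: "'a::metric_space \<Rightarrow> 'a"
  assumes "continuous_on K \<psi>"
  shows "continuous_on (forward_invariant_part \<psi> K) (\<psi> ^^ n)"
proof (induction n)
  case (Suc n)
  have "continuous_on (forward_invariant_part \<psi> K) (\<lambda>w. \<psi> ((\<psi> ^^ n) w))"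
    using assms Suc by (rule continuous_on_compose2) (auto simp: forward_invariant_part_def)
  then show ?case by (simp add: o_def)
qed (simp add: id_def)

text \<open>Realising every periodic word by a periodic point suffices: compactness carries
  invariance over to the closure of the periodic points, and disjointness of the compact sets
  \<open>K0\<close> and \<open>K1\<close> makes each symbol of the itinerary locally
  constant.\<close>

lemma chaotic_on_two_symbolsI:
  fixes \<psi> :: "'a::metric_space \<Rightarrow> 'a"
  assumes K: "compact K0" "compact K1" "K0 \<inter> K1 = {}" "K0 \<subseteq> D" "K1 \<subseteq> D"
    and cont: "continuous_on (K0 \<union> K1) \<psi>"
    and words: "\<And>k s. k > 0 \<Longrightarrow> s \<in> Sigma2 \<Longrightarrow> (shift ^^ k) s = s \<Longrightarrow>
      \<exists>w. (\<psi> ^^ k) w = w \<and> (\<forall>n. (\<psi> ^^ n) w \<in> (if s n = 0 then K0 else K1))"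
  shows "chaotic_on_two_symbols \<psi> D K0 K1"
proof -
  define J where "J = forward_invariant_part \<psi> (K0 \<union> K1)"
  define P where "P = periodic_points \<psi> J"
  define I where "I = closure P"
  \<comment> \<open>Within \<open>J\<close> every iterate lies in exactly one of \<open>K0\<close>
    and \<open>K1\<close>, so there the default symbol 1 means membership in
    \<open>K1\<close>.\<close>
  define \<pi> where "\<pi> w n = (if (\<psi> ^^ n) w \<in> K0 then 0 else 1 :: nat)" for w n
  have J: "compact J"
    unfolding J_def using K cont by (intro compact_forward_invariant_part compact_Un)
  have J_funpow: "(\<psi> ^^ n) w \<in> J" if "w \<in> J" for n w
    using that unfolding J_def by (rule forward_invariant_part_funpow)
  have J_orbit: "(\<psi> ^^ n) w \<in> K0 \<union> K1" if "w \<in> J" for n w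
    using that by (simp add: J_def forward_invariant_part_def)
  have periodic: "\<exists>w\<in>P. \<pi> w = s \<and> (\<psi> ^^ k) w = w \<and> (\<forall>n. (\<psi> ^^ n) w \<in> (if s n = 0 then K0 else K1))"
    if k: "k > 0" and s: "s \<in> Sigma2" "(shift ^^ k) s = s" for k s
  proof -
    obtain w where w: "(\<psi> ^^ k) w = w" "\<And>n. (\<psi> ^^ n) w \<in> (if s n = 0 then K0 else K1)"
      using words[OF k s] by blast
    have "(\<psi> ^^ n) w \<in> K0 \<union> K1" for n
      using w(2)[of n] by (auto split: if_splits)
    then have "w \<in> P"
      using k w(1) by (auto simp: P_def J_def periodic_points_def forward_invariant_part_def)
    moreover have "\<pi> w = s"
    proof
      fix n
      have "s n = 0 \<or> s n = 1" using s(1) by (auto simp: Sigma2_def)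
      then show "\<pi> w n = s n" using w(2)[of n] K(3) by (auto simp: \<pi>_def)
    qed
    ultimately show ?thesis using w by blast
  qed
  \<comment> \<open>The constant words have period 1; their points show that \<open>K0\<close> and
    \<open>K1\<close> are nonempty.\<close>
  have const: "\<exists>w\<in>P. w \<in> (if c = 0 then K0 else K1)" if "c \<in> {0, 1}" for c :: nat
  proof -
    have "(\<lambda>_. c) \<in> Sigma2" "(shift ^^ 1) (\<lambda>_. c) = (\<lambda>_. c)"
      using that by (auto simp: Sigma2_def shift_def)
    then obtain w where "w \<in> P" "(\<psi> ^^ 0) w \<in> (if c = 0 then K0 else K1)"
      using periodic[of 1 "\<lambda>_. c"] zero_less_one by blast
    then show ?thesis by auto
  qed
  have "K0 \<noteq> {}" "K1 \<noteq> {}" "P \<noteq> {}"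
    using const[of 0] const[of 1] by auto
  have "P \<subseteq> J" by (auto simp: P_def periodic_points_def)
  then have IJ: "I \<subseteq> J" unfolding I_def by (simp add: closure_minimal compact_imp_closed[OF J])
  then have "compact I"
    using compact_Int_closed[of J I] J by (simp add: I_def inf.absorb2)
  have PI: "P \<subseteq> I" unfolding I_def by (rule closure_subset)
  have cont_I: "continuous_on I (\<psi> ^^ n)" for n
    using continuous_on_funpow_forward_invariant_part[OF cont] IJ
    unfolding J_def by (rule continuous_on_subset)
  have cont_I1: "continuous_on I \<psi>" using cont_I[of 1] by simp
  have "\<psi> ` P = P"
  proof (intro equalityI subsetI)
    fix v assume "v \<in> \<psi> ` P"
    then obtain w k where w: "v = \<psi> w" "w \<in> J" "k > 0" "(\<psi> ^^ k) w = w"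
      by (auto simp: P_def periodic_points_def)
    then have "(\<psi> ^^ k) v = v" using funpow_swap1[of \<psi> k w] by simp
    moreover have "v \<in> J" using J_funpow[OF w(2), of 1] w(1) by simp
    ultimately show "v \<in> P" using w(3) by (auto simp: P_def periodic_points_def)
  next
    fix w assume "w \<in> P"
    then obtain k where w: "w \<in> J" "k > 0" "(\<psi> ^^ k) w = w"
      by (auto simp: P_def periodic_points_def)
    \<comment> \<open>On the cycle of \<open>w\<close>, the point just before the return to
      \<open>w\<close> is a periodic preimage.\<close>
    define v where "v = (\<psi> ^^ (k - 1)) w"
    have v: "\<psi> v = w" using w by (cases k) (auto simp: v_def)
    have "(\<psi> ^^ (k + (k - 1))) w = (\<psi> ^^ (k - 1 + k)) w"
      by (simp only: add.commute)
    then have "(\<psi> ^^ k) v = v"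
      unfolding v_def by (simp only: funpow_add o_apply w)
    then have "v \<in> P" using J_funpow w by (auto simp: P_def periodic_points_def v_def)
    with v show "w \<in> \<psi> ` P" by blast
  qed
  have "\<psi> ` I = I"
  proof
    show "\<psi> ` I \<subseteq> I"
      unfolding I_def
      by (rule image_closure_subset) (use cont_I1 \<open>\<psi> ` P = P\<close> closure_subset in \<open>auto simp: I_def\<close>)
    \<comment> \<open>The image of the compact set \<open>I\<close> is closed and contains
      \<open>P\<close>, hence also the closure of \<open>P\<close>.\<close>
    have "closed (\<psi> ` I)"
      using cont_I1 \<open>compact I\<close> by (simp add: compact_continuous_image compact_imp_closed)
    then show "I \<subseteq> \<psi> ` I"
      using image_mono[OF PI, of \<psi>] \<open>\<psi> ` P = P\<close> closure_minimal[of P "\<psi> ` I"] by (simp add: I_def)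
  qed
  have \<pi>_Sigma2: "\<pi> w \<in> Sigma2" for w
    by (auto simp: \<pi>_def Sigma2_def)
  \<comment> \<open>The points of \<open>I\<close> sharing the \<open>n\<close>-th symbol of
    \<open>w\<close> are those whose \<open>n\<close>-th iterate avoids the other compact set, so
    they form the complement of a relatively closed set.\<close>
  have clopen: "openin (top_of_set I) {v \<in> I. \<pi> v n = \<pi> w n}" if "w \<in> I" for w n
  proof -
    have cl: "closedin (top_of_set I) (I \<inter> (\<psi> ^^ n) -` K0)" "closedin (top_of_set I) (I \<inter> (\<psi> ^^ n) -` K1)"
      using K(1,2) by (intro continuous_closedin_preimage cont_I; simp add: compact_imp_closed)+
    have in_K: "(\<psi> ^^ n) v \<in> K0 \<union> K1" if "v \<in> I" for v
      using J_orbit IJ that by blast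
    have "{v \<in> I. \<pi> v n = \<pi> w n} =
        I - (if (\<psi> ^^ n) w \<in> K0 then I \<inter> (\<psi> ^^ n) -` K1 else I \<inter> (\<psi> ^^ n) -` K0)"
      using in_K K(3) by (auto simp: \<pi>_def split: if_splits)
    then show ?thesis
      using cl by (auto simp: openin_diff)
  qed
  have cylinder: "openin (top_of_set I) {v \<in> I. \<forall>n<N. \<pi> v n = \<pi> w n}" if w: "w \<in> I" for w N
  proof (induction N)
    case (Suc N)
    have "{v \<in> I. \<forall>n<Suc N. \<pi> v n = \<pi> w n} =
        {v \<in> I. \<forall>n<N. \<pi> v n = \<pi> w n} \<inter> {v \<in> I. \<pi> v N = \<pi> w N}"
      by (auto simp: less_Suc_eq)
    then show ?case using Suc clopen[OF w] by (simp add: openin_Int)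
  qed simp
  interpret S: Metric_space Sigma2 dist_Sigma2 by (rule Metric_space_Sigma2)
  have "continuous_map (top_of_set I) Sigma2_topology \<pi>"
    unfolding S.continuous_map_to_metric
  proof (intro ballI allI impI)
    fix w and \<epsilon> :: real
    assume "w \<in> topspace (top_of_set I)" "\<epsilon> > 0"
    then have w: "w \<in> I" by simp
    obtain N where N: "(1 / 2 :: real) ^ N < \<epsilon>"
      using real_arch_pow_inv[OF \<open>\<epsilon> > 0\<close>, of "1 / 2"] by auto
    have "\<pi> v \<in> S.mball (\<pi> w) \<epsilon>" if "\<forall>n<N. \<pi> v n = \<pi> w n" for v
      using dist_Sigma2_le[of N "\<pi> w" "\<pi> v"] N that by (simp add: S.in_mball \<pi>_Sigma2)
    then show "\<exists>U. openin (top_of_set I) U \<and> w \<in> U \<and> (\<forall>v\<in>U. \<pi> v \<in> S.mball (\<pi> w) \<epsilon>)"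
      using cylinder[OF w, of N] w by (intro exI[of _ "{v \<in> I. \<forall>n<N. \<pi> v n = \<pi> w n}"]) auto
  qed
  moreover have "\<pi> (\<psi> w) = shift (\<pi> w)" for w
    by (rule ext) (simp add: \<pi>_def shift_def del: funpow.simps add: funpow_Suc_right)
  moreover have "dense_subset (periodic_points \<psi> J) I"
    using PI by (simp add: dense_subset_def P_def[symmetric] I_def[symmetric])
  moreover have "\<exists>w\<in>I. \<pi> w = s \<and> (\<psi> ^^ k) w = w" if "k > 0" "s \<in> Sigma2" "(shift ^^ k) s = s" for k s
    using periodic[OF that] PI by blast
  ultimately have "\<exists>\<pi>. continuous_map (top_of_set I) Sigma2_topology \<pi> \<and>
      (\<forall>w\<in>I. \<pi> (\<psi> w) = shift (\<pi> w)) \<and> dense_subset (periodic_points \<psi> J) I \<and>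
      (\<forall>k>0. \<forall>s\<in>Sigma2. (shift ^^ k) s = s \<longrightarrow> (\<exists>w\<in>I. \<pi> w = s \<and> (\<psi> ^^ k) w = w))"
    by blast
  moreover have "I \<noteq> {}" "J \<noteq> {}" using \<open>P \<noteq> {}\<close> PI IJ by auto
  ultimately show ?thesis
    unfolding chaotic_on_two_symbols_def Let_def J_def[symmetric]
    using K \<open>K0 \<noteq> {}\<close> \<open>K1 \<noteq> {}\<close> J \<open>compact I\<close> IJ \<open>\<psi> ` I = I\<close> by blast
qed


text \<open>The two closed strips overlap in the plane at height \<open>m\<close>;
  \<open>escape\<close> removes this overlap from \<open>K0\<close> and \<open>K1\<close> and so
  makes them disjoint.\<close>

lemma two_strips_chaotic:
  fixes F :: "real \<times> real \<times> real \<Rightarrow> real \<times> real \<times> real" and x0 x1 y0 y1 c d m :: real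
  defines "R \<equiv> {x0..x1} \<times> {y0..y1} \<times> {c..d}"
  defines "Rl \<equiv> {x0..x1} \<times> {y0..y1} \<times> {c}" and "Rr \<equiv> {x0..x1} \<times> {y0..y1} \<times> {d}"
  assumes box: "x0 < x1" "y0 < y1" "c < m" "m < d"
    and cont: "continuous_on R F"
    and F12: "\<And>w. w \<in> R \<Longrightarrow> fst (F w) \<in> {x0..x1} \<and> fst (snd (F w)) \<in> {y0..y1}"
    and cross: "strip_crossing F {x0..x1} {y0..y1} c d c m" "strip_crossing F {x0..x1} {y0..y1} c d m d"
    and escape: "\<And>x y. x \<in> {x0..x1} \<Longrightarrow> y \<in> {y0..y1} \<Longrightarrow> F (x, y, m) \<notin> R"
  shows "\<exists>K0 K1. compact K0 \<and> compact K1 \<and> K0 \<subseteq> R \<and> K1 \<subseteq> R \<and> K0 \<inter> K1 = {} \<and>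
    stretches_along_paths K0 F (R, Rl, Rr) (R, Rl, Rr) \<and>
    stretches_along_paths K1 F (R, Rl, Rr) (R, Rl, Rr) \<and>
    chaotic_on_two_symbols F R K0 K1"
proof -
  define S where "S l r = {x0..x1} \<times> {y0..y1} \<times> {l..r}" for l r :: real
  define K0 where "K0 = {w \<in> S c m. F w \<in> R}"
  define K1 where "K1 = {w \<in> S m d. F w \<in> R}"
  have S_R: "S l r \<subseteq> R" if "c \<le> l" "r \<le> d" for l r
    using that by (auto simp: S_def R_def)
  have stretch: "stretches_along_paths {w \<in> S l r. F w \<in> R} F (R, Rl, Rr) (R, Rl, Rr)"
    if "c \<le> l" "l < r" "r \<le> d" "strip_crossing F {x0..x1} {y0..y1} c d l r" for l r
    unfolding S_def R_def Rl_def Rr_def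
    by (rule strip_crossing_stretches)
       (use that box F12 continuous_on_subset[OF cont S_R[of l r]] S_R[of l r]
         in \<open>auto simp: S_def R_def\<close>)
  have stretch0: "stretches_along_paths K0 F (R, Rl, Rr) (R, Rl, Rr)"
    unfolding K0_def by (rule stretch) (use box cross in auto)
  have stretch1: "stretches_along_paths K1 F (R, Rl, Rr) (R, Rl, Rr)"
    unfolding K1_def by (rule stretch) (use box cross in auto)
  have K: "compact K0" "compact K1" "K0 \<subseteq> R" "K1 \<subseteq> R"
    using stretch0 stretch1 by auto
  have disj: "K0 \<inter> K1 = {}"
    using escape by (auto simp: K0_def K1_def S_def dest: order_antisym)
  have "chaotic_on_two_symbols F R K0 K1"
  proof (rule chaotic_on_two_symbolsI)
    show "continuous_on (K0 \<union> K1) F"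
      using K by (intro continuous_on_subset[OF cont]) auto
    fix k s assume k: "k > 0" and "s \<in> Sigma2" and period: "(shift ^^ k) s = s"
    have "s (i + k) = s i" for i
      using fun_cong[OF period, of i] by (simp add: shift_funpow)
    then have "s (i + q * k) = s i" for i q
      by (induction q) (simp_all add: add.commute[of k] flip: add.assoc)
    from this[of "n mod k" "n div k" for n] have s_mod: "s (n mod k) = s n" for n
      by simp
    \<comment> \<open>The symbol \<open>s j\<close> selects the strip of the \<open>j\<close>-th
      point: the lower one for 0, the upper one otherwise.\<close>
    define l r where "l j = (if s j = 0 then c else m)" and "r j = (if s j = 0 then m else d)" for j
    have lr: "c \<le> l j" "l j \<le> r j" "r j \<le> d" for j
      using box by (auto simp: l_def r_def)
    have "\<exists>w. \<forall>j<k. w j \<in> S (l j) (r j) \<and> F (w j) = w (Suc j mod k)"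
      unfolding S_def
    proof (rule strip_crossing_cyclic_orbit)
      show "strip_crossing F {x0..x1} {y0..y1} c d (l j) (r j)" for j
        using cross by (simp add: l_def r_def)
      show "continuous_on ({x0..x1} \<times> {y0..y1} \<times> {l j..r j}) F" for j
        using continuous_on_subset[OF cont S_R[OF lr(1) lr(3)]] by (simp add: S_def)
      show "fst (F w) \<in> {x0..x1} \<and> fst (snd (F w)) \<in> {y0..y1}"
        if "w \<in> {x0..x1} \<times> {y0..y1} \<times> {l j..r j}" for j w
        using F12[of w] S_R[OF lr(1) lr(3), of j j] that unfolding S_def by blast
    qed (use k box lr in auto)
    then obtain w where w: "\<And>j. j < k \<Longrightarrow> w j \<in> S (l j) (r j)" "\<And>j. j < k \<Longrightarrow> F (w j) = w (Suc j mod k)"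
      by blast
    have orbit: "(F ^^ n) (w 0) = w (n mod k)" for n
      by (induction n) (use k w(2) in \<open>auto simp: mod_Suc_eq\<close>)
    \<comment> \<open>Membership in \<open>K0\<close> or \<open>K1\<close> also asks for the image
      to be in \<open>R\<close>; the image is the next point of the cycle, which lies in its own
      strip.\<close>
    have wR: "w (n mod k) \<in> R" for n
      using w(1)[of "n mod k"] S_R[OF lr(1) lr(3)] k by auto
    have "(F ^^ n) (w 0) \<in> (if s n = 0 then K0 else K1)" for n
      using w(1)[of "n mod k"] w(2)[of "n mod k"] wR[of "Suc n"] k
      by (auto simp: orbit l_def r_def s_mod K0_def K1_def mod_Suc_eq)
    moreover have "(F ^^ k) (w 0) = w 0" by (simp add: orbit)
    ultimately show "\<exists>w. (F ^^ k) w = w \<and> (\<forall>n. (F ^^ n) w \<in> (if s n = 0 then K0 else K1))"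
      by blast
  qed (use K disj in auto)
  then show ?thesis using K disj stretch0 stretch1 by blast
qed

section \<open>Estimates for the map\<close>

text \<open>Cross-multiplied form of the fact that \<open>w / (w + h)\<^sup>2\<close> decreases for
  \<open>w > h\<close>; right side minus left side factors as
  \<open>(w - v) * (w * v - h * h)\<close>.\<close>

lemma ratio_sq_antimono:
  fixes h v w :: real
  assumes "0 \<le> h" "h < v" "v \<le> w"
  shows "(v + h)\<^sup>2 * w \<le> (w + h)\<^sup>2 * v"
proof -
  have "h * h \<le> w * v" using assms by (intro mult_mono) auto
  then have "0 \<le> (w - v) * (w * v - h * h)"
    using assms by (intro mult_nonneg_nonneg) auto
  then show ?thesis by (simp add: power2_eq_square algebra_simps)
qed

text \<open>With \<open>p = sqrt (u / c)\<close> the expression becomes the quadratic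
  \<open>p - c * p\<^sup>2\<close>, which decreases beyond its vertex \<open>1 / (2 * c)\<close>;
  the lower bound on \<open>u\<close> places \<open>p\<close> there.\<close>

lemma sqrt_divide_minus_antimono:
  fixes c u v :: real
  assumes "0 < c" "1 / (4 * c) \<le> u" "u \<le> v"
  shows "sqrt (v / c) - v \<le> sqrt (u / c) - u"
proof -
  define p q where "p = sqrt (u / c)" and "q = sqrt (v / c)"
  have "1 / (4 * c) > 0" using assms by simp
  then have pos: "0 < u" "0 < v" using assms by linarith+
  have "p \<le> q" using assms by (simp add: p_def q_def divide_right_mono)
  have "(1 / (2 * c))\<^sup>2 \<le> u / c"
    using assms by (simp add: field_simps power2_eq_square)
  then have "1 / (2 * c) \<le> p"
    unfolding p_def by (rule real_le_rsqrt)
  then have "1 \<le> 2 * (c * p)"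
    using assms by (simp add: field_simps)
  moreover have "c * p \<le> c * q"
    using \<open>p \<le> q\<close> assms by simp
  ultimately have "1 \<le> c * (p + q)"
    by (simp add: distrib_left)
  then have "0 \<le> (q - p) * (c * (p + q) - 1)"
    using \<open>p \<le> q\<close> by (intro mult_nonneg_nonneg) auto
  moreover have "u = c * p\<^sup>2" "v = c * q\<^sup>2"
    using pos assms by (auto simp: p_def q_def)
  ultimately show ?thesis
    unfolding p_def[symmetric] q_def[symmetric]
    by (simp add: algebra_simps power2_eq_square)
qed

text \<open>Here \<open>s\<close> stands for the sum of the last two coordinates. The expression
  increases in \<open>x\<close>, and at \<open>x0\<close> also in \<open>s\<close>, so its least
  value is at the corner \<open>(x0, s0)\<close>. For the upper bound take \<open>x = x1\<close> and
  \<open>u = x1 + s\<close>: then \<open>u - c1 * u\<^sup>2\<close> is at most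
  \<open>1 / (4 * c1)\<close>, hence at most \<open>x1\<close>.\<close>

lemma fst_triopoly_map_range:
  fixes c1 x0 x1 s0 s1 :: real
  assumes c1: "0 < c1" and bounds: "0 < x0" "0 < s0" "1 / c1 - x1 > s1" "x1 \<ge> 1 / (4 * c1)"
    "1 / (2 * c1) * (1 - c1 * (s0 + s1)) \<ge> x0" "sqrt (s0 / c1) - s0 \<ge> x0"
    and x: "x0 \<le> x" "x \<le> x1" and s: "s0 \<le> s" "s \<le> s1"
  shows "(2 * x + s - c1 * (x + s)\<^sup>2) / 2 \<in> {x0..x1}"
proof -
  have sum: "c1 * (2 * (x1 + s1)) < 2"
    using bounds(3) c1 by (simp add: field_simps)
  have mid: "c1 * (2 * x0 + s0 + s1) \<le> 1"
    using bounds(5) c1 by (simp add: field_simps)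
  have "x0 + s0 \<le> sqrt (s0 / c1)" using bounds(6) by simp
  then have "(x0 + s0)\<^sup>2 \<le> (sqrt (s0 / c1))\<^sup>2"
    using bounds by (intro power_mono) auto
  then have corner: "c1 * (x0 + s0)\<^sup>2 \<le> s0"
    using c1 bounds by (simp add: field_simps)
  \<comment> \<open>The increments of the doubled expression factor: \<open>1\<close> and
    \<open>3\<close> are those in \<open>x\<close> from \<open>x0\<close> and up to
    \<open>x1\<close>, and \<open>2\<close> is the one in \<open>s\<close> at
    \<open>x0\<close>.\<close>
  have "c1 * (x + x0 + 2 * s) \<le> c1 * (2 * (x1 + s1))"
    using c1 x s by (intro mult_left_mono) auto
  then have 1: "0 \<le> (x - x0) * (2 - c1 * (x + x0 + 2 * s))"
    using sum x by (intro mult_nonneg_nonneg) linarith+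
  have "c1 * (2 * x0 + s0 + s) \<le> c1 * (2 * x0 + s0 + s1)"
    using c1 s by (intro mult_left_mono) auto
  then have 2: "0 \<le> (s - s0) * (1 - c1 * (2 * x0 + s0 + s))"
    using mid s by (intro mult_nonneg_nonneg) auto
  have "c1 * (x + x1 + 2 * s) \<le> c1 * (2 * (x1 + s1))"
    using c1 x s by (intro mult_left_mono) auto
  then have 3: "0 \<le> (x1 - x) * (2 - c1 * (x + x1 + 2 * s))"
    using sum x by (intro mult_nonneg_nonneg) linarith+
  have "0 \<le> (2 * c1 * (x1 + s) - 1)\<^sup>2" by simp
  then have 4: "4 * c1 * ((x1 + s) - c1 * (x1 + s)\<^sup>2) \<le> 1"
    by (simp add: power2_eq_square algebra_simps)
  have "1 \<le> 4 * c1 * x1" using bounds(4) c1 by (simp add: field_simps)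
  with 4 have "4 * c1 * ((x1 + s) - c1 * (x1 + s)\<^sup>2) \<le> 4 * c1 * x1" by linarith
  then have 5: "(x1 + s) - c1 * (x1 + s)\<^sup>2 \<le> x1"
    using c1 by simp
  have "x0 * 2 \<le> 2 * x + s - c1 * (x + s)\<^sup>2"
    using 1 2 corner by (simp add: power2_eq_square algebra_simps)
  moreover have "2 * x + s - c1 * (x + s)\<^sup>2 \<le> x1 * 2"
    using 3 5 by (simp add: power2_eq_square algebra_simps)
  ultimately show ?thesis by simp
qed

text \<open>Squaring \<open>le\<close> gives
  \<open>\<alpha> * v \<le> (\<alpha> * c3 - 1) * (v + z)\<^sup>2\<close>, so the growth factor of
  \<open>z\<close> is nonpositive at \<open>v\<close>. Since \<open>w / (w + z)\<^sup>2\<close>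
  decreases, it remains so for larger \<open>w\<close>.\<close>

lemma growth_nonpos:
  fixes \<alpha> c3 v w z :: real
  assumes "0 < \<alpha>" "1 < \<alpha> * c3" "0 < z" "z < v" "v \<le> w" and le: "sqrt (\<alpha> / (\<alpha> * c3 - 1) * v) - v \<le> z"
  shows "z + \<alpha> * z * (- c3 + w / (w + z)\<^sup>2) \<le> 0"
proof -
  define A where "A = \<alpha> / (\<alpha> * c3 - 1)"
  have "A > 0" using assms by (simp add: A_def)
  have "(sqrt (A * v))\<^sup>2 \<le> (v + z)\<^sup>2"
    using le assms \<open>A > 0\<close> unfolding A_def[symmetric] by (intro power_mono) auto
  then have "A * v \<le> (v + z)\<^sup>2"
    using assms \<open>A > 0\<close> by simp
  then have "A * v * w \<le> (v + z)\<^sup>2 * w"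
    using assms by (intro mult_right_mono) auto
  also have "\<dots> \<le> (w + z)\<^sup>2 * v"
    using assms by (intro ratio_sq_antimono) auto
  finally have "v * (A * w) \<le> v * (w + z)\<^sup>2" by (simp add: mult_ac)
  then have "A * w \<le> (w + z)\<^sup>2" using assms by simp
  then have "\<alpha> * w \<le> (\<alpha> * c3 - 1) * (w + z)\<^sup>2"
    using assms unfolding A_def by (simp add: field_simps)
  moreover have "(w + z)\<^sup>2 > 0" using assms by simp
  ultimately have "\<alpha> * (w / (w + z)\<^sup>2) \<le> \<alpha> * c3 - 1"
    by (simp add: pos_divide_le_eq)
  then have "z * (1 - \<alpha> * c3 + \<alpha> * (w / (w + z)\<^sup>2)) \<le> 0"
    using assms by (intro mult_nonneg_nonpos) auto
  then show ?thesis by (simp add: algebra_simps)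
qed

text \<open>Now \<open>v\<close> is the largest argument, where growth is weakest: squaring
  \<open>less\<close> makes the growth factor exceed 2 at \<open>v\<close>, and monotonicity of
  \<open>w / (w + z)\<^sup>2\<close> carries this over to smaller \<open>w\<close>.\<close>

lemma growth_more_than_doubles:
  fixes \<alpha> c3 v w z :: real
  assumes "0 < \<alpha>" "0 < c3" "0 < z" "z < w" "w \<le> v" and less: "z < sqrt (\<alpha> / (\<alpha> * c3 + 1) * v) - v"
  shows "2 * z < z + \<alpha> * z * (- c3 + w / (w + z)\<^sup>2)"
proof -
  define A where "A = \<alpha> / (\<alpha> * c3 + 1)"
  have pos: "\<alpha> * c3 + 1 > 0" using assms by (simp add: add_pos_pos)
  then have "A > 0" using assms by (simp add: A_def)
  have "(v + z)\<^sup>2 < (sqrt (A * v))\<^sup>2"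
    using less assms unfolding A_def[symmetric] by (intro power_strict_mono) auto
  then have *: "(v + z)\<^sup>2 < A * v"
    using assms \<open>A > 0\<close> by simp
  have "(w + z)\<^sup>2 * v \<le> (v + z)\<^sup>2 * w"
    using assms by (intro ratio_sq_antimono) auto
  also have "\<dots> < A * v * w"
    using * assms by (intro mult_strict_right_mono) auto
  finally have "v * (w + z)\<^sup>2 < v * (A * w)" by (simp add: mult_ac)
  then have "(w + z)\<^sup>2 < A * w" using assms by simp
  then have "(\<alpha> * c3 + 1) * (w + z)\<^sup>2 < \<alpha> * w"
    using pos unfolding A_def by (simp add: field_simps)
  moreover have "(w + z)\<^sup>2 > 0" using assms by simp
  ultimately have "\<alpha> * c3 + 1 < \<alpha> * (w / (w + z)\<^sup>2)"
    by (simp add: pos_less_divide_eq)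
  then have "0 < z * (\<alpha> * (w / (w + z)\<^sup>2) - \<alpha> * c3 - 1)"
    using assms by (intro mult_pos_pos) auto
  then show ?thesis by (simp add: algebra_simps)
qed

section \<open>Verification of the strip conditions for the triopoly map\<close>

theorem theorem3p1:
  fixes c1 c2 c3 \<alpha> xl xr yl yr zl zr :: real
    and F :: "real \<times> real \<times> real \<Rightarrow> real \<times> real \<times> real"
    and R Rl Rr :: "(real \<times> real \<times> real) set"
  assumes params: "c1 = 4 / 10" "c2 = 55 / 100" "c3 = 6 / 10" "\<alpha> = 17"
    and F: "F = triopoly_map c1 c2 c3 \<alpha>"
    and less: "xl < xr" "yl < yr" "zl < zr"
    and cond1: "zl = 0"
    and cond2: "xl + yl > zr"
      "zr \<ge> sqrt (\<alpha> / (\<alpha> * c3 - 1) * (xl + yl)) - (xl + yl)"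
      "sqrt (\<alpha> / (\<alpha> * c3 - 1) * (xl + yl)) - (xl + yl) > 0"
    and cond3: "2 * (sqrt (\<alpha> / (\<alpha> * c3 + 1) * (xr + yr)) - (xr + yr)) > zr"
    and cond4: "1 / c1 - xr > yr + zr" "yr + zr > 1 / (2 * c1) - xl" "1 / (2 * c1) - xl > 0"
      "1 / (2 * c1) - xr > yl + zl"
      "xr \<ge> 1 / (4 * c1)"
      "1 / (2 * c1) * (1 - c1 * (yl + yr + zl + zr)) \<ge> xl" "xl > 0"
      "sqrt ((yl + zl) / c1) - (yl + zl) \<ge> xl"
    and cond5: "xl + zl > 1 / (4 * c2)"
      "yr \<ge> sqrt ((xl + zl) / c2) - (xl + zl)" "sqrt ((xl + zl) / c2) - (xl + zl) > 0"
      "sqrt ((xr + zr) / c2) - (xr + zr) \<ge> yl" "yl > 0"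
    and R: "R = {xl..xr} \<times> {yl..yr} \<times> {zl..zr}"
    and Rl: "Rl = {xl..xr} \<times> {yl..yr} \<times> {zl}"
    and Rr: "Rr = {xl..xr} \<times> {yl..yr} \<times> {zr}"
  shows "\<exists>K0 K1. compact K0 \<and> compact K1 \<and> K0 \<subseteq> R \<and> K1 \<subseteq> R \<and> K0 \<inter> K1 = {} \<and>
           stretches_along_paths K0 F (R, Rl, Rr) (R, Rl, Rr) \<and>
           stretches_along_paths K1 F (R, Rl, Rr) (R, Rl, Rr) \<and>
           chaotic_on_two_symbols F R K0 K1"
proof -
  have R0: "zl = 0" "0 < zr" using cond1 less by auto
  \<comment> \<open>\<open>y + z\<close> is kept as one term, to serve as the variable
    \<open>s\<close> in the estimate of the first component.\<close>
  have val: "F (x, y, z) = ((2 * x + (y + z) - c1 * (x + (y + z))\<^sup>2) / 2,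
      sqrt ((x + z) / c2) - (x + z), z + \<alpha> * z * (- c3 + ((x + y) / (x + y + z)\<^sup>2)))" for x y z
    by (simp add: F triopoly_map_def add.assoc algebra_simps)
  have cont: "continuous_on R F"
    unfolding F triopoly_map_def case_prod_unfold R using cond4(7) cond5(5) R0
    by (intro continuous_intros) (auto simp: params add_nonneg_eq_0_iff)
  have x_range: "fst (F (x, y, z)) \<in> {xl..xr}"
    if "x \<in> {xl..xr}" "y \<in> {yl..yr}" "z \<in> {zl..zr}" for x y z
    unfolding val fst_conv
    by (rule fst_triopoly_map_range[where ?s0.0 = "yl + zl" and ?s1.0 = "yr + zr"])
       (use cond4 cond5(5) R0 that in \<open>auto simp: params(1) add.assoc\<close>)
  have y_range: "fst (snd (F (x, y, z))) \<in> {yl..yr}"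
    if "x \<in> {xl..xr}" "y \<in> {yl..yr}" "z \<in> {zl..zr}" for x y z
  proof -
    have "c2 > 0" by (simp add: params)
    \<comment> \<open>The second component depends on \<open>x + z\<close> only and decreases from
      \<open>1 / (4 * c2)\<close> on, so it is bounded by its values at \<open>xr + zr\<close> and
      \<open>xl + zl\<close>.\<close>
    then have "sqrt ((x + z) / c2) - (x + z) \<le> sqrt ((xl + zl) / c2) - (xl + zl)"
      "sqrt ((xr + zr) / c2) - (xr + zr) \<le> sqrt ((x + z) / c2) - (x + z)"
      using that cond5(1) by (auto intro!: sqrt_divide_minus_antimono)
    then show ?thesis
      using cond5 by (simp add: val)
  qed
  have bottom: "snd (snd (F (x, y, zl))) = zl" for x y
    by (simp add: val R0)
  \<comment> \<open>Growth at height \<open>zr\<close> is strongest for the smallest sum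
    \<open>xl + yl\<close>, which is the sum that \<open>cond2\<close> controls.\<close>
  have top: "snd (snd (F (x, y, zr))) \<le> zl" if "x \<in> {xl..xr}" "y \<in> {yl..yr}" for x y
    unfolding val snd_conv R0
    by (rule growth_nonpos[where v = "xl + yl"]) (use that R0 cond2 in \<open>auto simp: params\<close>)
  have middle: "zr < snd (snd (F (x, y, zr / 2)))" if "x \<in> {xl..xr}" "y \<in> {yl..yr}" for x y
  proof -
    \<comment> \<open>At half height, growth by more than the factor 2 overshoots \<open>zr\<close>;
      \<open>cond3\<close> ensures it at the weakest sum \<open>xr + yr\<close>.\<close>
    have "2 * (zr / 2) < zr / 2 + \<alpha> * (zr / 2) * (- c3 + (x + y) / (x + y + zr / 2)\<^sup>2)"
    proof (rule growth_more_than_doubles[where v = "xr + yr"])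
      show "zr / 2 < x + y" using that R0 cond2(1) by auto
      show "zr / 2 < sqrt (\<alpha> / (\<alpha> * c3 + 1) * (xr + yr)) - (xr + yr)" using cond3 by simp
    qed (use that R0 in \<open>auto simp: params\<close>)
    then show ?thesis by (simp add: val)
  qed
  show ?thesis
    unfolding R Rl Rr
  proof (rule two_strips_chaotic)
    show "strip_crossing F {xl..xr} {yl..yr} zl zr zl (zr / 2)"
      using bottom middle by (auto simp: strip_crossing_def less_imp_le)
    show "strip_crossing F {xl..xr} {yl..yr} zl zr (zr / 2) zr"
      using top middle by (auto simp: strip_crossing_def less_imp_le)
    show "F (x, y, zr / 2) \<notin> {xl..xr} \<times> {yl..yr} \<times> {zl..zr}"
      if "x \<in> {xl..xr}" "y \<in> {yl..yr}" for x y
      using middle[OF that] by (auto simp: mem_Times_iff)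
    show "fst (F w) \<in> {xl..xr} \<and> fst (snd (F w)) \<in> {yl..yr}"
      if "w \<in> {xl..xr} \<times> {yl..yr} \<times> {zl..zr}" for w
      using that x_range y_range by (cases w) auto
  qed (use less R0 cont R in auto)
qed

end
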